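(* Let $\mathfrak{X},\mathfrak{Y},\mathfrak{Z}$ be linear spaces over $\mathbb{K}$, let $A$ be (the graph of) an operator between $\mathfrak{X}$ and $\mathfrak{Z}$, and let $B$ be a linear relation between $\mathfrak{Y}$ and $\mathfrak{Z}$. The following statements are equivalent: (i) there exists an operator $C$ between $\mathfrak{X}$ and $\mathfrak{Y}$ such that $A\subseteq BC$; (ii) $\mathrm{ran}\,A\subseteq\mathrm{ran}\,B$.
   Context: $\mathbb{K}$ is $\mathbb{R}$ or $\mathbb{C}$. A linear relation between linear spaces $\mathfrak{X}$ and $\mathfrak{Y}$ is a linear subspace $R$ of $\mathfrak{X}\times\mathfrak{Y}$. Put $\mathrm{ran}\,R=\{y:(x,y)\in R\text{ for some }x\}$ and $\mathrm{mul}\,R=\{y:(0,y)\in R\}$. For linear relations $R\subseteq\mathfrak{X}\times\mathfrak{Y}$ and $S\subseteq\mathfrak{Y}\times\mathfrak{Z}$ the product is $SR=\{(x,z):(x,y)\in R\text{ and }(y,z)\in S\text{ for some }y\in\mathfrak{Y}\}$. An operator between $\mathfrak{X}$ and $\mathfrak{Y}$ is a linear map defined on a linear subspace of $\mathfrak{X}$ (not necessarily all of $\mathfrak{X}$) with values in $\mathfrak{Y}$; it is identified with its graph, i.e. with a linear relation $R\subseteq\mathfrak{X}\times\mathfrak{Y}$ satisfying $\mathrm{mul}\,R=\{0\}$. *)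

theory Defs
  imports "HOL-Analysis.Product_Vector"
begin

(* The scalar field is R or C.  To treat both cases in one statement, the class contains the
   fields isomorphic to real or to complex as abstract fields; no topology or order is involved. *)
class real_or_complex = field +
  assumes real_or_complex:
    "(\<exists>\<phi>::'a \<Rightarrow> real. bij \<phi> \<and> \<phi> 1 = 1 \<and>
        (\<forall>a b. \<phi> (a + b) = \<phi> a + \<phi> b) \<and> (\<forall>a b. \<phi> (a * b) = \<phi> a * \<phi> b)) \<or>
     (\<exists>\<phi>::'a \<Rightarrow> complex. bij \<phi> \<and> \<phi> 1 = 1 \<and>
        (\<forall>a b. \<phi> (a + b) = \<phi> a + \<phi> b) \<and> (\<forall>a b. \<phi> (a * b) = \<phi> a * \<phi> b))"

instance real :: real_or_complex
  by standard (rule disjI1, rule exI[of _ id], simp)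

instance complex :: real_or_complex
  by standard (rule disjI2, rule exI[of _ id], simp)

(* The product SR of relations is R O S in the notation of HOL, and ran R is Range R. *)
definition linear_relation ::
  "('k::field \<Rightarrow> 'x::ab_group_add \<Rightarrow> 'x) \<Rightarrow> ('k \<Rightarrow> 'y::ab_group_add \<Rightarrow> 'y) \<Rightarrow> ('x \<times> 'y) set \<Rightarrow> bool"
  where "linear_relation sX sY R \<longleftrightarrow> module.subspace (module_prod.scale sX sY) R"

definition mul :: "('x::zero \<times> 'y) set \<Rightarrow> 'y set"
  where "mul R = {y. (0, y) \<in> R}"

(* An operator is identified with its graph; its domain may be a proper subspace. *)
definition operator ::
  "('k::field \<Rightarrow> 'x::ab_group_add \<Rightarrow> 'x) \<Rightarrow> ('k \<Rightarrow> 'y::ab_group_add \<Rightarrow> 'y) \<Rightarrow> ('x \<times> 'y) set \<Rightarrow> bool"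
  where "operator sX sY R \<longleftrightarrow> linear_relation sX sY R \<and> mul R = {0}"

end

(* The linear relation A O B\<inverse>, i.e. B^{-1}A in the order of the paper, consists of the admissible
   pairs (x, y).  Prescribing admissible values on a basis of its domain and extending linearly
   gives a linear map whose graph is a suitable C. *)
theory Submission
  imports Defs
begin

text \<open>Trades the scaling of the product module for closure conditions on pairs, the form in
  which all later arguments use linearity.\<close>

lemma linear_relation_iff:
  assumes "vector_space sX" and "vector_space sY"
  shows "linear_relation sX sY R \<longleftrightarrow>
    (0, 0) \<in> R \<and>
    (\<forall>x y x' y'. (x, y) \<in> R \<longrightarrow> (x', y') \<in> R \<longrightarrow> (x + x', y + y') \<in> R) \<and>
    (\<forall>c x y. (x, y) \<in> R \<longrightarrow> (sX c x, sY c y) \<in> R)"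
proof -
  interpret X: vector_space sX by fact
  interpret Y: vector_space sY by fact
  interpret module_prod sX sY ..
  show ?thesis
    unfolding linear_relation_def p.subspace_def
    by (simp add: scale_def zero_prod_def split_paired_all Ball_def)
qed

lemma linear_relation_relcomp_converse:
  assumes "vector_space sX" "vector_space sY" "vector_space sZ"
    and "linear_relation sX sZ A" "linear_relation sY sZ B"
  shows "linear_relation sX sY (A O B\<inverse>)"
proof -
  note A = assms(4)[unfolded linear_relation_iff[OF assms(1,3)]]
  note B = assms(5)[unfolded linear_relation_iff[OF assms(2,3)]]
  have "(x + x', y + y') \<in> A O B\<inverse>"
    if "(x, y) \<in> A O B\<inverse>" "(x', y') \<in> A O B\<inverse>" for x y x' y'
  proof -
    from that obtain z z' where "(x, z) \<in> A" "(y, z) \<in> B" "(x', z') \<in> A" "(y', z') \<in> B"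
      by blast
    then have "(x + x', z + z') \<in> A" "(y + y', z + z') \<in> B"
      using A B by simp_all
    then show ?thesis by blast
  qed
  moreover have "(sX c x, sY c y) \<in> A O B\<inverse>" if "(x, y) \<in> A O B\<inverse>" for c x y
  proof -
    from that obtain z where "(x, z) \<in> A" "(y, z) \<in> B" by blast
    then have "(sX c x, sZ c z) \<in> A" "(sY c y, sZ c z) \<in> B"
      using A B by simp_all
    then show ?thesis by blast
  qed
  moreover have "(0, 0) \<in> A O B\<inverse>"
    using A B by blast
  ultimately show ?thesis
    unfolding linear_relation_iff[OF assms(1,2)] by simp
qed

text \<open>Pairs of \<open>R\<close> over basis vectors may be chosen freely, and closure of
  \<open>R\<close> under linear combinations carries the choice to the whole domain. The map
  \<open>f\<close> is total; outside \<open>Domain R\<close> its values are not tied to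
  \<open>R\<close>.\<close>

lemma linear_relation_selection:
  assumes "vector_space sX" "vector_space sY" and R: "linear_relation sX sY R"
  obtains f where "Vector_Spaces.linear sX sY f" and "\<And>x. x \<in> Domain R \<Longrightarrow> (x, f x) \<in> R"
proof -
  interpret vector_space_pair sX sY
    using assms(1,2) by (rule vector_space_pair.intro)
  note R = R[unfolded linear_relation_iff[OF assms(1,2)]]
  obtain E where E: "E \<subseteq> Domain R" "vs1.independent E" "Domain R \<subseteq> vs1.span E"
    using vs1.maximal_independent_subset by blast
  from E(1) have "\<forall>e\<in>E. \<exists>y. (e, y) \<in> R" by blast
  then obtain g where g: "\<forall>e\<in>E. (e, g e) \<in> R"
    by (rule bchoice[THEN exE])
  obtain f where f: "Vector_Spaces.linear sX sY f" and fg: "\<forall>e\<in>E. f e = g e"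
    using linear_independent_extend[OF E(2)] by blast
  interpret f: Vector_Spaces.linear sX sY f by fact
  \<comment> \<open>The points where \<open>f\<close> selects correctly are the preimage of
    \<open>R\<close> under the linear map sending \<open>x\<close> to \<open>(x, f x)\<close>. Hence
    it suffices that they include \<open>E\<close>, whose span covers
    \<open>Domain R\<close>.\<close>
  have "vs1.subspace {x. (x, f x) \<in> R}"
    using R by (auto simp: vs1.subspace_def f.add f.scale f.zero)
  then have "vs1.span E \<subseteq> {x. (x, f x) \<in> R}"
    using g fg by (intro vs1.span_minimal) auto
  with E(3) f show thesis
    by (intro that) auto
qed

lemma operator_graph:
  assumes "Vector_Spaces.linear sX sY f"
  shows "operator sX sY {(x, f x) |x. True}"
proof -
  interpret Vector_Spaces.linear sX sY f by fact
  have "vector_space sX" "vector_space sY" ..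
  then show ?thesis
    by (auto simp: operator_def mul_def linear_relation_iff add scale zero)
qed

text \<open>Subtracting the two pairs leaves \<open>(0, y - y')\<close> in \<open>R\<close>, so
  \<open>y - y'\<close> lies in \<open>mul R\<close>, which is trivial.\<close>

lemma operator_single_valued:
  assumes "vector_space sX" "vector_space sY" and "operator sX sY R"
    and "(x, y) \<in> R" "(x, y') \<in> R"
  shows "y = y'"
proof -
  interpret X: vector_space sX by fact
  interpret Y: vector_space sY by fact
  have R: "linear_relation sX sY R" "mul R = {0}"
    using assms(3) by (auto simp: operator_def)
  note R1 = R(1)[unfolded linear_relation_iff[OF assms(1,2)]]
  have "(sX (-1) x, sY (-1) y') \<in> R"
    using R1 assms(5) by blast
  then have "(x + sX (-1) x, y + sY (-1) y') \<in> R"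
    using R1 assms(4) by blast
  then have "y - y' \<in> mul R"
    by (simp add: mul_def)
  with R(2) show ?thesis by simp
qed

theorem corollary3p2:
  fixes sX :: "'k::real_or_complex \<Rightarrow> 'x::ab_group_add \<Rightarrow> 'x"
    and sY :: "'k \<Rightarrow> 'y::ab_group_add \<Rightarrow> 'y"
    and sZ :: "'k \<Rightarrow> 'z::ab_group_add \<Rightarrow> 'z"
    and A :: "('x \<times> 'z) set"
    and B :: "('y \<times> 'z) set"
  assumes "vector_space sX" and "vector_space sY" and "vector_space sZ"
    and "operator sX sZ A"
    and "linear_relation sY sZ B"
  shows "(\<exists>C. operator sX sY C \<and> A \<subseteq> C O B) \<longleftrightarrow> Range A \<subseteq> Range B"
proof
  assume "\<exists>C. operator sX sY C \<and> A \<subseteq> C O B"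
  then show "Range A \<subseteq> Range B" by blast
next
  assume ran: "Range A \<subseteq> Range B"
  have "linear_relation sX sY (A O B\<inverse>)"
    using assms by (intro linear_relation_relcomp_converse) (auto simp: operator_def)
  then obtain f where f: "Vector_Spaces.linear sX sY f"
    and sel: "\<And>x. x \<in> Domain (A O B\<inverse>) \<Longrightarrow> (x, f x) \<in> A O B\<inverse>"
    using linear_relation_selection assms(1,2) by blast
  have "(f x, z) \<in> B" if xz: "(x, z) \<in> A" for x z
  proof -
    \<comment> \<open>The range inclusion supplies some \<open>y\<close> with
      \<open>(y, z) \<in> B\<close>, so \<open>x\<close> has an admissible partner.\<close>
    from xz ran have "x \<in> Domain (A O B\<inverse>)" by blast
    \<comment> \<open>The selection only links \<open>f x\<close> to some value \<open>z'\<close> of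
      \<open>A\<close> at \<open>x\<close>. As \<open>A\<close> is an operator, \<open>z'\<close>
      must be the given \<open>z\<close>.\<close>
    then obtain z' where "(x, z') \<in> A" "(f x, z') \<in> B"
      using sel by blast
    with xz show ?thesis
      using operator_single_valued[OF assms(1,3,4)] by blast
  qed
  \<comment> \<open>The witness \<open>C\<close> is the graph of \<open>f\<close> on the whole
    space. Its domain may exceed that of \<open>A\<close>, which is harmless because only an
    inclusion is claimed.\<close>
  then have "A \<subseteq> {(x, f x) |x. True} O B" by (auto intro: relcompI)
  with operator_graph[OF f] show "\<exists>C. operator sX sY C \<and> A \<subseteq> C O B" by blast
qed

end
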